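(* For all integers $k\geq1$ and $n\geq0$, $$p(n)=p\left(n-\left\lfloor\frac{n}{k}\right\rfloor k\right)+\sum_{j=0}^{\lfloor n/k\rfloor-1}\nu_k(n-jk),$$ where the sum is empty (equal to $0$) if $n<k$.
   Context: $p(n)$ is the number of integer partitions of $n$, with $p(0)=1$. For $k\geq1$, $\nu_k(n)$ denotes the number of integer partitions of $n$ having no part equal to $k$, with $\nu_k(0):=1$. $\lfloor x\rfloor$ is the floor function. *)

theory Defs
  imports Complex_Main "HOL-Library.Multiset"
begin

definition int_partitions :: "nat \<Rightarrow> nat multiset set" where
  "int_partitions n = {M. 0 \<notin># M \<and> sum_mset M = n}"

definition p :: "nat \<Rightarrow> nat" where
  "p n = card (int_partitions n)"

definition nu :: "nat \<Rightarrow> nat \<Rightarrow> nat" where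
  "nu k n = card {M \<in> int_partitions n. k \<notin># M}"

text \<open>Finiteness ensures that the cardinalities above are genuine counts; the two
  conventions for the argument \<open>0\<close> hold because the empty multiset is the only
  partition of \<open>0\<close>.\<close>

lemma size_le_sum_mset:
  fixes M :: "nat multiset"
  assumes "0 \<notin># M"
  shows "size M \<le> sum_mset M"
  using assms by (induction M) auto

lemma finite_int_partitions: "finite (int_partitions n)"
proof (rule finite_subset)
  show "int_partitions n \<subseteq> mset ` {xs. set xs \<subseteq> {..n} \<and> length xs \<le> n}"
  proof
    fix M assume M: "M \<in> int_partitions n"
    obtain xs where xs: "M = mset xs"
      by (metis ex_mset)
    have "x \<le> n" if "x \<in># M" for x
      using M that by (auto simp: int_partitions_def sum_mset.remove)
    moreover have "size M \<le> n"
      using M size_le_sum_mset by (auto simp: int_partitions_def)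
    ultimately show "M \<in> mset ` {xs. set xs \<subseteq> {..n} \<and> length xs \<le> n}"
      using xs by (auto intro!: imageI)
  qed
  show "finite (mset ` {xs. set xs \<subseteq> {..n} \<and> length xs \<le> n})"
    by (intro finite_imageI finite_lists_length_le) simp
qed

lemma int_partitions_0: "int_partitions 0 = {{#}}"
  by (auto simp: int_partitions_def) (metis multiset_nonemptyE)

lemma p_0: "p 0 = 1"
  by (simp add: p_def int_partitions_0)

lemma nu_0: "nu k 0 = 1"
proof -
  have "{M \<in> int_partitions 0. k \<notin># M} = {{#}}"
    by (auto simp: int_partitions_0)
  then show ?thesis
    by (simp add: nu_def)
qed

end

theory Submission
  imports Defs
begin

text \<open>Deleting one copy of \<open>k\<close> matches the partitions of \<open>n\<close> that
  contain \<open>k\<close> with all partitions of \<open>n - k\<close>; the others are counted by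
  \<open>nu k n\<close>. Hence the recurrence \<open>p_eq_p_diff_plus_nu\<close> for
  \<open>k \<le> n\<close>. It can be applied \<open>n div k\<close> times, and the
  \<open>nu\<close> terms pile up into the sum.\<close>

lemma card_partitions_with_part:
  assumes "1 \<le> k" "k \<le> n"
  shows "card {M \<in> int_partitions n. k \<in># M} = p (n - k)"
proof -
  have "bij_betw (add_mset k) (int_partitions (n - k)) {M \<in> int_partitions n. k \<in># M}"
    \<comment> \<open>\<open>1 \<le> k\<close> keeps 0 from becoming a part when \<open>k\<close> is
      added.\<close>
    by (rule bij_betw_byWitness[where f' = "\<lambda>M. M - {#k#}"])
      (use assms in \<open>auto simp: int_partitions_def sum_mset_diff dest: in_diffD\<close>)
  then show ?thesis
    by (simp add: p_def bij_betw_same_card)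
qed

lemma p_eq_p_diff_plus_nu:
  assumes "1 \<le> k" "k \<le> n"
  shows "p n = p (n - k) + nu k n"
proof -
  have "int_partitions n = {M \<in> int_partitions n. k \<in># M} \<union> {M \<in> int_partitions n. k \<notin># M}"
    by auto
  then have "p n = card {M \<in> int_partitions n. k \<in># M} + nu k n"
    unfolding p_def nu_def
    by (metis (mono_tags, lifting) card_Un_disjoint disjoint_iff finite_Un finite_int_partitions
        mem_Collect_eq)
  then show ?thesis
    using card_partitions_with_part[OF assms] by simp
qed

text \<open>The recurrence unrolled \<open>m\<close> times. A free \<open>m\<close> allows
  induction; the theorem is the case \<open>m = n div k\<close>.\<close>

lemma p_eq_p_diff_mult_plus_sum_nu:
  assumes "1 \<le> k" "m * k \<le> n"
  shows "p n = p (n - m * k) + (\<Sum>j<m. nu k (n - j * k))"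
  using assms(2)
proof (induction m)
  case (Suc m)
  \<comment> \<open>\<open>Suc m * k \<le> n\<close> leaves at least \<open>k\<close> in
    \<open>n - m * k\<close>, so the recurrence applies once more.\<close>
  then have "p (n - m * k) = p (n - m * k - k) + nu k (n - m * k)"
    using assms(1) by (intro p_eq_p_diff_plus_nu) auto
  with Suc show ?case
    by (simp add: add.commute)
qed simp

theorem mainTheorem5:
  fixes k n :: nat
  assumes "k \<ge> 1"
  shows "p n = p (n - (n div k) * k) + (\<Sum>j<n div k. nu k (n - j * k))"
  using assms by (intro p_eq_p_diff_mult_plus_sum_nu) auto

end
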